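(* Let $D=(D_t)_{t\ge0}$ be a subordinator starting at $0$, with killing rate $0$, drift $0$, infinite Lévy measure $\nu$ and Laplace exponent $\psi$, and let $E=(E_t)_{t\ge0}$ be its inverse. Assume that $\psi$ is regularly varying at $\infty$ with index $\beta\in[0,1)$. If $\beta=0$, assume further that $\lim_{s\to\infty}\psi(s)=\infty$ and that $\psi'$ is regularly varying at $\infty$ with index $-1$. Let $f:(0,\infty)\to(0,\infty)$ be a measurable function regularly varying at $\infty$ with index $p>0$ such that $\sup_{0<s\le s_0}f(s)<\infty$ for every $0<s_0<\infty$. Fix $t>0$. (i) If $p<1/(1-\beta)$ (equivalently, $\beta>(p-1)/p$), then $\mathbb{E}[e^{f(E_t)}]<\infty$. (ii) If $p>1/(1-\beta)$ (equivalently, $\beta<(p-1)/p$), then $\mathbb{E}[e^{f(E_t)}]=\infty$.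
   Context: All processes are defined on a complete probability space $(\Omega,\mathcal{F},\mathbb{P})$ with expectation $\mathbb{E}$. A subordinator $D$ with killing rate $0$, drift $0$ and Lévy measure $\nu$ is a one-dimensional nondecreasing Lévy process with càdlàg paths starting at $0$ such that $\mathbb{E}[e^{-sD_t}]=e^{-t\psi(s)}$, where $\psi(s)=\int_0^\infty(1-e^{-sy})\,\nu(\mathrm{d}y)$ is its Laplace exponent and $\int_0^\infty (y\wedge1)\,\nu(\mathrm{d}y)<\infty$. The Lévy measure is infinite if $\nu(0,\infty)=\infty$. The inverse of $D$ is $E_t:=\inf\{u>0: D_u>t\}$, $t\ge0$; for $t>0$ one has $E_t>0$ almost surely. A function $f:(0,\infty)\to(0,\infty)$ is regularly varying at $\infty$ with index $p\in\mathbb{R}$ if $\lim_{s\to\infty}f(cs)/f(s)=c^p$ for every $c>0$. *)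

theory Defs
  imports "HOL-Probability.Probability"
begin

text \<open>
  Real functions of a positive argument are total functions of type \<^typ>\<open>real \<Rightarrow> real\<close>;
  only their values on the open half-line matter.
\<close>

definition regularly_varying :: "(real \<Rightarrow> real) \<Rightarrow> real \<Rightarrow> bool" where
  "regularly_varying f p \<longleftrightarrow>
     (\<forall>s>0. f s > 0) \<and> (\<forall>c>0. ((\<lambda>s. f (c * s) / f s) \<longlongrightarrow> c powr p) at_top)"

definition cadlag_on_nonneg :: "(real \<Rightarrow> real) \<Rightarrow> bool" where
  "cadlag_on_nonneg x \<longleftrightarrow>
     (\<forall>t\<ge>0. (x \<longlongrightarrow> x t) (at_right t)) \<and> (\<forall>t>0. \<exists>l. (x \<longlongrightarrow> l) (at_left t))"

text \<open>
  Processes are indexed by \<^typ>\<open>real\<close>, with only the indices \<open>t \<ge> 0\<close> being relevant, and path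
  properties are required almost surely. Continuity in probability, often listed among the
  axioms of a Levy process, follows from the stationarity of the increments and right
  continuity at \<open>0\<close>.
\<close>

definition levy_process :: "'a measure \<Rightarrow> (real \<Rightarrow> 'a \<Rightarrow> real) \<Rightarrow> bool" where
  "levy_process M X \<longleftrightarrow>
     (\<forall>t\<ge>0. X t \<in> borel_measurable M) \<and>
     (AE \<omega> in M. X 0 \<omega> = 0) \<and>
     (\<forall>(n::nat) \<tau>. 0 \<le> \<tau> 0 \<and> (\<forall>i<n. \<tau> i \<le> \<tau> (Suc i)) \<longrightarrow>
        prob_space.indep_vars M (\<lambda>_. borel) (\<lambda>i \<omega>. X (\<tau> (Suc i)) \<omega> - X (\<tau> i) \<omega>) {..<n}) \<and>
     (\<forall>s\<ge>0. \<forall>h\<ge>0. distr M borel (\<lambda>\<omega>. X (s + h) \<omega> - X s \<omega>) = distr M borel (X h)) \<and>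
     (AE \<omega> in M. cadlag_on_nonneg (\<lambda>t. X t \<omega>))"

text \<open>A Levy measure of a subordinator is a Borel measure whose space is the open half-line.\<close>

definition subordinator_levy_measure :: "real measure \<Rightarrow> bool" where
  "subordinator_levy_measure \<nu> \<longleftrightarrow>
     sets \<nu> = sets (restrict_space borel {0<..}) \<and> (\<integral>\<^sup>+y. ennreal (min y 1) \<partial>\<nu>) < \<infinity>"

definition laplace_exponent :: "real measure \<Rightarrow> real \<Rightarrow> real" where
  "laplace_exponent \<nu> s = (\<integral>y. (1 - exp (- s * y)) \<partial>\<nu>)"

text \<open>
  Killing rate \<open>0\<close> and drift \<open>0\<close> are expressed by the processes being real-valued and by the
  absence of a constant and of a linear term in the Laplace exponent.
\<close>

definition subordinator :: "'a measure \<Rightarrow> (real \<Rightarrow> 'a \<Rightarrow> real) \<Rightarrow> real measure \<Rightarrow> bool" where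
  "subordinator M D \<nu> \<longleftrightarrow>
     levy_process M D \<and>
     (AE \<omega> in M. mono_on {0..} (\<lambda>t. D t \<omega>)) \<and>
     subordinator_levy_measure \<nu> \<and>
     (\<forall>t\<ge>0. \<forall>s\<ge>0. prob_space.expectation M (\<lambda>\<omega>. exp (- s * D t \<omega>))
                       = exp (- t * laplace_exponent \<nu> s))"

text \<open>
  The inverse takes values in \<^typ>\<open>ereal\<close>, so that it equals \<open>\<infinity>\<close> on the paths that never
  exceed \<open>t\<close>.
\<close>

definition inverse_subordinator :: "(real \<Rightarrow> 'a \<Rightarrow> real) \<Rightarrow> real \<Rightarrow> 'a \<Rightarrow> ereal" where
  "inverse_subordinator D t \<omega> = (INF u\<in>{u. 0 < u \<and> t < D u \<omega>}. ereal u)"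

text \<open>
  The expectation of \<open>exp (f (E\<^sub>t))\<close> as an element of \<open>[0, \<infinity>]\<close>. For \<open>t > 0\<close> the inverse of a
  subordinator with infinite Levy measure lies in the open half-line almost surely, so the value
  \<open>f 0\<close> used where the inverse is \<open>0\<close> or \<open>\<infinity>\<close> is irrelevant.
\<close>

definition exp_moment_inverse ::
    "'a measure \<Rightarrow> (real \<Rightarrow> 'a \<Rightarrow> real) \<Rightarrow> (real \<Rightarrow> real) \<Rightarrow> real \<Rightarrow> ennreal" where
  "exp_moment_inverse M D f t =
     (\<integral>\<^sup>+\<omega>. ennreal (exp (f (real_of_ereal (inverse_subordinator D t \<omega>)))) \<partial>M)"

end

theory Submission
  imports Defs "HOL-Real_Asymp.Real_Asymp"
begin

text \<open>
  Paths being nondecreasing, \<open>E\<^sub>t > u\<close> implies \<open>D\<^sub>u \<le> t\<close>, which in turn implies \<open>E\<^sub>t \<ge> u\<close>, so both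
  parts are about the decay of \<open>P (D\<^sub>u \<le> t)\<close>. The Laplace transform controls it from both sides:
  \<open>exp (- u \<psi>(s)) - exp (- s t) \<le> P (D\<^sub>u \<le> t) \<le> exp (s t - u \<psi>(s))\<close> for every \<open>s \<ge> 0\<close>.
  With \<open>s = u^a\<close> and \<open>\<psi>(s) = s^(\<beta> + o(1))\<close>, the terms \<open>s t\<close> and \<open>u \<psi>(s)\<close> balance at the critical
  exponent \<open>a = 1 / (1 - \<beta>)\<close>: for smaller \<open>a\<close> the upper bound decays like \<open>exp (- u^q)\<close> with some
  \<open>q > a\<close>, and for larger \<open>a\<close> the lower bound is of order at least \<open>exp (- u^r)\<close> with some \<open>r < a\<close>.
  Choosing \<open>a\<close> between \<open>p\<close> and \<open>1 / (1 - \<beta>)\<close> and comparing with \<open>f(u) = u^(p + o(1))\<close> settles both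
  cases.
\<close>

section \<open>Slow variation in additive form and power bounds for regularly varying
  functions\<close>

text \<open>Since the increments vanish pointwise along \<open>y\<close>, the sets
  \<open>W n\<close> increase to the whole interval, and continuity from below applies. As in
  Egorov's theorem, pointwise smallness becomes uniform smallness off a set of small
  measure.\<close>

lemma measure_small_increments:
  fixes k :: "real \<Rightarrow> real" and y :: "nat \<Rightarrow> real"
  assumes k [measurable]: "k \<in> borel_measurable borel"
    and lim: "\<And>u. ((\<lambda>x. k (x + u) - k x) \<longlongrightarrow> 0) at_top"
    and y: "filterlim y at_top sequentially"
    and "e > 0" "b \<ge> 0"
  defines "W \<equiv> \<lambda>n. {z \<in> {0..b}. \<forall>m\<ge>n. \<bar>k (y m + z) - k (y m)\<bar> < e}"
  shows "W n \<in> lmeasurable" and "(\<lambda>n. measure lebesgue (W n)) \<longlonglongrightarrow> b"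
proof -
  have borel: "W n \<in> sets borel" for n
    unfolding W_def by measurable
  have lm: "W n \<in> lmeasurable" for n
  proof (rule fmeasurableI2)
    show "{0..b} \<in> lmeasurable" by simp
    show "W n \<in> sets lebesgue" using borel by simp
  qed (auto simp: W_def)
  show "W n \<in> lmeasurable" by (rule lm)
  have inc: "incseq W"
    unfolding W_def incseq_def by auto
  have union: "(\<Union>n. W n) = {0..b}"
  proof
    show "{0..b} \<subseteq> (\<Union>n. W n)"
    proof
      fix z assume z: "z \<in> {0..b}"
      have "((\<lambda>m. k (y m + z) - k (y m)) \<longlongrightarrow> 0) sequentially"
        by (rule filterlim_compose[OF lim y])
      then have "eventually (\<lambda>m. dist (k (y m + z) - k (y m)) 0 < e) sequentially"
        using \<open>e > 0\<close> by (rule tendstoD)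
      then show "z \<in> (\<Union>n. W n)"
        using z by (auto simp: eventually_sequentially W_def)
    qed
  qed (auto simp: W_def)
  have "(\<lambda>n. measure lebesgue (W n)) \<longlonglongrightarrow> measure lebesgue (\<Union>n. W n)"
    by (rule Lim_measure_incseq) (use lm inc union in \<open>auto simp: emeasure_lborel_Icc_eq\<close>)
  then show "(\<lambda>n. measure lebesgue (W n)) \<longlonglongrightarrow> b"
    using union \<open>b \<ge> 0\<close> by simp
qed

text \<open>
  Karamata's uniform convergence theorem. If it fails along \<open>x\<^sub>m + u\<^sub>m\<close>, the sets of \<open>y\<close> in \<open>[0, 2]\<close>
  at which \<open>k\<close> is close to \<open>k (x\<^sub>m)\<close>, respectively to \<open>k (x\<^sub>m + u\<^sub>m)\<close>, have total measure above 2,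
  so they meet.
\<close>
lemma additive_slowly_varying_uniform:
  fixes k :: "real \<Rightarrow> real"
  assumes k: "k \<in> borel_measurable borel"
    and lim: "\<And>u. ((\<lambda>x. k (x + u) - k x) \<longlongrightarrow> 0) at_top"
    and "e > 0"
  shows "\<exists>X. \<forall>x\<ge>X. \<forall>u\<in>{0..1}. \<bar>k (x + u) - k x\<bar> < e"
proof (rule ccontr)
  assume "\<not> ?thesis"
  then have "\<forall>n::nat. \<exists>x u. x \<ge> real n \<and> u \<in> {0..1} \<and> \<bar>k (x + u) - k x\<bar> \<ge> e"
    by (meson not_less)
  then obtain x u :: "nat \<Rightarrow> real" where
    xu: "\<And>n. x n \<ge> real n" "\<And>n. u n \<in> {0..1}" "\<And>n. \<bar>k (x n + u n) - k (x n)\<bar> \<ge> e"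
    by metis
  have x: "filterlim x at_top sequentially"
    using filterlim_real_sequentially by (rule filterlim_at_top_mono) (simp add: xu(1))
  have "x n \<le> x n + u n" for n using xu(2)[of n] by auto
  then have xpu: "filterlim (\<lambda>n. x n + u n) at_top sequentially"
    by (intro filterlim_at_top_mono[OF x] always_eventually) blast
  have e2: "e / 2 > 0" using \<open>e > 0\<close> by simp
  define U where "U = (\<lambda>n. {z \<in> {0..2}. \<forall>m\<ge>n. \<bar>k (x m + z) - k (x m)\<bar> < e / 2})"
  define V where
    "V = (\<lambda>n. {z \<in> {0..1}. \<forall>m\<ge>n. \<bar>k (x m + u m + z) - k (x m + u m)\<bar> < e / 2})"
  have U: "U n \<in> lmeasurable" "(\<lambda>n. measure lebesgue (U n)) \<longlonglongrightarrow> 2" for n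
    unfolding U_def by (rule measure_small_increments[OF k lim x e2], simp)+
  have V: "V n \<in> lmeasurable" "(\<lambda>n. measure lebesgue (V n)) \<longlonglongrightarrow> 1" for n
    unfolding V_def by (rule measure_small_increments[OF k lim xpu e2], simp)+
  have "eventually (\<lambda>n. measure lebesgue (U n) > 3 / 2) sequentially"
    using U(2) by (rule order_tendstoD) simp
  moreover have "eventually (\<lambda>n. measure lebesgue (V n) > 1 / 2) sequentially"
    using V(2) by (rule order_tendstoD) simp
  ultimately have "eventually (\<lambda>n. measure lebesgue (U n) > 3 / 2 \<and> measure lebesgue (V n) > 1 / 2)
      sequentially"
    by (rule eventually_conj)
  then obtain n where n: "measure lebesgue (U n) > 3 / 2" "measure lebesgue (V n) > 1 / 2"
    by (auto simp: eventually_sequentially)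
  \<comment> \<open>\<open>V n\<close> holds offsets from \<open>x n + u n\<close>. Translating by
    \<open>u n\<close> turns them into offsets from \<open>x n\<close>, comparable with
    \<open>U n\<close>, and keeps them in [0, 2] because \<open>u n\<close> is at most 1.\<close>
  define V' where "V' = (+) (u n) ` V n"
  have V': "V' \<in> lmeasurable" "measure lebesgue V' > 1 / 2"
    unfolding V'_def using V(1) n(2) by (auto simp: measurable_translation measure_translation)
  have "U n \<inter> V' \<noteq> {}"
  proof
    assume "U n \<inter> V' = {}"
    then have "V' - U n = V'" by blast
    then have "measure lebesgue (U n \<union> V') = measure lebesgue (U n) + measure lebesgue V'"
      using U(1) V'(1) by (simp add: measure_Un2)
    moreover have "U n \<union> V' \<subseteq> {0..2}"
      using xu(2)[of n] by (auto simp: U_def V'_def V_def)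
    then have "measure lebesgue (U n \<union> V') \<le> measure lebesgue {0..2::real}"
      using U(1) V'(1) by (intro measure_mono_fmeasurable) auto
    ultimately show False using n V'(2) by simp
  qed
  then obtain z where z: "z \<in> V n" "u n + z \<in> U n"
    unfolding V'_def by auto
  have "\<bar>k (x n + (u n + z)) - k (x n)\<bar> < e / 2"
    using z(2) unfolding U_def by blast
  moreover have "\<bar>k (x n + u n + z) - k (x n + u n)\<bar> < e / 2"
    using z(1) unfolding V_def by blast
  then have "\<bar>k (x n + (u n + z)) - k (x n + u n)\<bar> < e / 2"
    by (simp only: add.assoc)
  ultimately show False using xu(3)[of n] by linarith
qed

text \<open>Telescoping over unit steps beyond \<open>X\<close>, each changing \<open>k\<close> by
  less than \<open>e / 2\<close>, bounds the growth by slope \<open>e / 2\<close>. The other half of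
  \<open>e\<close> absorbs the constants for large \<open>x\<close>.\<close>

lemma additive_slowly_varying_sublinear:
  fixes k :: "real \<Rightarrow> real"
  assumes k: "k \<in> borel_measurable borel"
    and lim: "\<And>u. ((\<lambda>x. k (x + u) - k x) \<longlongrightarrow> 0) at_top"
    and "e > 0"
  shows "eventually (\<lambda>x. \<bar>k x\<bar> \<le> e * x) at_top"
proof -
  obtain X where X: "\<And>x u. x \<ge> X \<Longrightarrow> u \<in> {0..1} \<Longrightarrow> \<bar>k (x + u) - k x\<bar> < e / 2"
    using additive_slowly_varying_uniform[OF k lim, of "e / 2"] \<open>e > 0\<close> half_gt_zero by blast
  have step: "\<bar>k (X + real n) - k X\<bar> \<le> real n * (e / 2)" for n
  proof (induction n)
    case (Suc n)
    have "\<bar>k (X + real n + 1) - k (X + real n)\<bar> < e / 2" by (rule X) auto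
    moreover have "k (X + real (Suc n)) = k (X + real n + 1)" by (simp add: algebra_simps)
    moreover have "real (Suc n) * (e / 2) = real n * (e / 2) + e / 2" by (simp add: algebra_simps)
    ultimately show ?case using Suc by linarith
  qed simp
  have bound: "\<bar>k x\<bar> \<le> \<bar>k X\<bar> + (x - X + 1) * (e / 2)" if "x \<ge> X" for x
  proof -
    define n where "n = nat \<lfloor>x - X\<rfloor>"
    have n: "real n \<le> x - X" "x - X - real n \<le> 1"
      unfolding n_def using that by linarith+
    have "\<bar>k (X + real n + (x - X - real n)) - k (X + real n)\<bar> < e / 2"
      using n by (intro X) auto
    then have "\<bar>k x - k (X + real n)\<bar> < e / 2" by simp
    moreover have "real n * (e / 2) \<le> (x - X) * (e / 2)"
      using n(1) \<open>e > 0\<close> by (intro mult_right_mono) auto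
    moreover have "(x - X + 1) * (e / 2) = (x - X) * (e / 2) + e / 2" by (simp add: distrib_right)
    ultimately show ?thesis using step[of n] by linarith
  qed
  have "eventually (\<lambda>x. \<bar>k X\<bar> + (x - X + 1) * (e / 2) \<le> e * x) at_top"
    using \<open>e > 0\<close> by real_asymp
  then show ?thesis
    using eventually_ge_at_top[of X] by eventually_elim (use bound in fastforce)
qed

text \<open>In logarithmic coordinates, \<open>k\<close> is the deviation of \<open>ln f\<close>
  from a line of slope \<open>p\<close>, and regular variation says that its increments vanish. Its
  sublinear growth, read at \<open>ln s\<close>, is the claim after exponentiation.\<close>

lemma regularly_varying_powr_bounds:
  assumes f: "f \<in> borel_measurable (restrict_space borel {0<..})"
    and rv: "regularly_varying f p" and "e > 0"
  shows "eventually (\<lambda>x. x powr (p - e) \<le> f x \<and> f x \<le> x powr (p + e)) at_top"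
proof -
  have pos: "f s > 0" if "s > 0" for s
    using rv that by (simp add: regularly_varying_def)
  define k where "k = (\<lambda>x. ln (f (exp x)) - p * x)"
  have "exp \<in> borel \<rightarrow>\<^sub>M restrict_space borel {0::real<..}"
    by (rule measurable_restrict_space2) auto
  from measurable_compose[OF this f] have k_meas: "k \<in> borel_measurable borel"
    unfolding k_def by measurable
  have k_lim: "((\<lambda>x. k (x + u) - k x) \<longlongrightarrow> 0) at_top" for u
  proof -
    have "((\<lambda>s. f (exp u * s) / f s) \<longlongrightarrow> exp u powr p) at_top"
      using rv by (simp add: regularly_varying_def)
    then have "((\<lambda>x. f (exp u * exp x) / f (exp x)) \<longlongrightarrow> exp u powr p) at_top"
      by (rule filterlim_compose) (rule exp_at_top)
    then have "((\<lambda>x. ln (f (exp u * exp x) / f (exp x)) - p * u) \<longlongrightarrow> ln (exp u powr p) - p * u)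
        at_top"
      by (intro tendsto_intros) auto
    moreover have "ln (f (exp u * exp x) / f (exp x)) - p * u = k (x + u) - k x" for x
      using pos[of "exp x"] pos[of "exp u * exp x"]
      by (simp add: k_def ln_div exp_add algebra_simps)
    moreover have "ln (exp u powr p) - p * u = 0" by (simp add: ln_powr)
    ultimately show ?thesis by simp
  qed
  have "eventually (\<lambda>x. \<bar>k x\<bar> \<le> e * x) at_top"
    using k_meas k_lim \<open>e > 0\<close> by (rule additive_slowly_varying_sublinear)
  then have "eventually (\<lambda>s. \<bar>k (ln s)\<bar> \<le> e * ln s) at_top"
    by (rule eventually_compose_filterlim) (rule ln_at_top)
  then show ?thesis
    using eventually_gt_at_top[of 0]
  proof eventually_elim
    case (elim s)
    have bnd: "(p - e) * ln s \<le> ln (f s)" "ln (f s) \<le> (p + e) * ln s"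
      using elim by (auto simp: k_def algebra_simps abs_le_iff)
    have "s powr (p - e) \<le> exp (ln (f s))" "exp (ln (f s)) \<le> s powr (p + e)"
      using bnd elim(2) by (auto simp: powr_def)
    then show ?case using pos[OF elim(2)] by simp
  qed
qed

section \<open>Pathwise comparison of \<open>D\<close> with its inverse\<close>

lemma le_of_less_inverse_subordinator:
  assumes "0 < u" "ereal u < inverse_subordinator D t \<omega>"
  shows "D u \<omega> \<le> t"
proof (rule ccontr)
  assume "\<not> ?thesis"
  then have "inverse_subordinator D t \<omega> \<le> ereal u"
    unfolding inverse_subordinator_def using assms(1) by (intro INF_lower) auto
  then show False using assms(2) by simp
qed

lemma le_inverse_subordinator:
  assumes mono: "mono_on {0..} (\<lambda>t. D t \<omega>)" and "0 \<le> u" "D u \<omega> \<le> t"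
  shows "ereal u \<le> inverse_subordinator D t \<omega>"
  unfolding inverse_subordinator_def
proof (rule INF_greatest)
  fix v assume v: "v \<in> {u. 0 < u \<and> t < D u \<omega>}"
  have "u \<le> v"
  proof (rule ccontr)
    assume "\<not> u \<le> v"
    then have "D v \<omega> \<le> D u \<omega>" using mono v by (auto intro: mono_onD)
    then show False using v assms(3) by auto
  qed
  then show "ereal u \<le> ereal v" by simp
qed

lemma inverse_subordinator_nonneg: "0 \<le> inverse_subordinator D t \<omega>"
  unfolding inverse_subordinator_def by (rule INF_greatest) auto

section \<open>Laplace transform estimates for the distribution of \<open>D\<close>\<close>

locale subordinator_space = prob_space M
  for M :: "'a measure" +
  fixes D :: "real \<Rightarrow> 'a \<Rightarrow> real" and \<nu> :: "real measure"
  assumes subordinator: "subordinator M D \<nu>"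
begin

lemma D_measurable [measurable]: "u \<ge> 0 \<Longrightarrow> D u \<in> borel_measurable M"
  using subordinator by (simp add: subordinator_def levy_process_def)

lemma AE_D_0: "AE \<omega> in M. D 0 \<omega> = 0"
  using subordinator by (simp add: subordinator_def levy_process_def)

lemma AE_mono_on_D: "AE \<omega> in M. mono_on {0..} (\<lambda>t. D t \<omega>)"
  using subordinator by (simp add: subordinator_def)

lemma AE_D_nonneg:
  assumes "u \<ge> 0"
  shows "AE \<omega> in M. D u \<omega> \<ge> 0"
  using AE_D_0 AE_mono_on_D
proof eventually_elim
  case (elim \<omega>)
  then show ?case using mono_onD[OF elim(2), of 0 u] assms by simp
qed

lemma expectation_exp_D:
  "u \<ge> 0 \<Longrightarrow> s \<ge> 0 \<Longrightarrow>
    expectation (\<lambda>\<omega>. exp (- s * D u \<omega>)) = exp (- u * laplace_exponent \<nu> s)"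
  using subordinator by (simp add: subordinator_def)

lemma integrable_exp_D:
  assumes "u \<ge> 0" "s \<ge> 0"
  shows "integrable M (\<lambda>\<omega>. exp (- s * D u \<omega>))"
  \<comment> \<open>The Bochner integral of a non-integrable function is 0 by default, whereas this
    one is an exponential and so nonzero.\<close>
  using expectation_exp_D[OF assms] by (metis exp_not_eq_zero not_integrable_integral_eq)

text \<open>Read off from the transform at time 1: \<open>D 1\<close> is almost surely nonnegative,
  so \<open>exp (- s * D 1 \<omega>)\<close> decreases in \<open>s\<close>. The detour avoids any
  integration against \<nu>.\<close>

lemma mono_on_laplace_exponent: "mono_on {0..} (laplace_exponent \<nu>)"
proof (rule mono_onI)
  fix r s :: real assume rs: "r \<in> {0..}" "s \<in> {0..}" "r \<le> s"
  have "expectation (\<lambda>\<omega>. exp (- s * D 1 \<omega>)) \<le> expectation (\<lambda>\<omega>. exp (- r * D 1 \<omega>))"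
  proof (rule integral_mono_AE)
    show "AE \<omega> in M. exp (- s * D 1 \<omega>) \<le> exp (- r * D 1 \<omega>)"
      using AE_D_nonneg[of 1] by (rule AE_mp) (use rs in \<open>auto intro!: AE_I2 mult_right_mono\<close>)
  qed (use rs integrable_exp_D in auto)
  then show "laplace_exponent \<nu> r \<le> laplace_exponent \<nu> s"
    using rs expectation_exp_D[of 1] by simp
qed

text \<open>Supplies the measurability under which the power bounds apply to the Laplace
  exponent.\<close>

lemma measurable_laplace_exponent:
  "laplace_exponent \<nu> \<in> borel_measurable (restrict_space borel {0<..})"
  by (rule borel_measurable_mono_on_fnc)
    (rule monotone_on_subset[OF mono_on_laplace_exponent], auto)

text \<open>Chernoff bound: the indicator of the event is dominated by
  \<open>exp (s * (t - D u \<omega>))\<close>.\<close>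

lemma prob_D_le_upper:
  assumes "u \<ge> 0" "s \<ge> 0"
  shows "prob {\<omega> \<in> space M. D u \<omega> \<le> t} \<le> exp (s * t - u * laplace_exponent \<nu> s)"
proof -
  have "prob {\<omega> \<in> space M. D u \<omega> \<le> t} = expectation (indicator {\<omega> \<in> space M. D u \<omega> \<le> t})"
    using assms by simp
  also have "\<dots> \<le> expectation (\<lambda>\<omega>. exp (s * t) * exp (- s * D u \<omega>))"
  proof (rule integral_mono)
    fix \<omega>
    have "1 \<le> exp (s * t) * exp (- s * D u \<omega>)" if "D u \<omega> \<le> t"
      using assms that by (simp add: mult_left_mono flip: exp_add)
    then show "indicator {\<omega> \<in> space M. D u \<omega> \<le> t} \<omega> \<le> exp (s * t) * exp (- s * D u \<omega>)"
      by (auto simp: indicator_def)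
  next
    show "integrable M (indicator {\<omega> \<in> space M. D u \<omega> \<le> t} :: _ \<Rightarrow> real)"
      using assms by (intro integrable_real_indicator) (auto simp: emeasure_eq_measure)
  qed (use integrable_exp_D[OF assms] in auto)
  also have "\<dots> = exp (s * t) * exp (- u * laplace_exponent \<nu> s)"
    using expectation_exp_D[OF assms] by simp
  also have "\<dots> = exp (s * t - u * laplace_exponent \<nu> s)"
    by (simp flip: exp_add)
  finally show ?thesis .
qed

text \<open>Split the transform at level \<open>t\<close>: the integrand is almost surely at most 1
  where \<open>D u \<omega> \<le> t\<close>, and at most \<open>exp (- s * t)\<close>
  elsewhere.\<close>

lemma prob_D_le_lower:
  assumes "u \<ge> 0" "s \<ge> 0"
  shows "exp (- u * laplace_exponent \<nu> s) - exp (- s * t) \<le> prob {\<omega> \<in> space M. D u \<omega> \<le> t}"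
proof -
  have int: "integrable M (indicator {\<omega> \<in> space M. D u \<omega> \<le> t} :: _ \<Rightarrow> real)"
    using assms by (intro integrable_real_indicator) (auto simp: emeasure_eq_measure)
  have "exp (- u * laplace_exponent \<nu> s) = expectation (\<lambda>\<omega>. exp (- s * D u \<omega>))"
    using expectation_exp_D[OF assms] by simp
  also have "\<dots> \<le> expectation (\<lambda>\<omega>. indicator {\<omega> \<in> space M. D u \<omega> \<le> t} \<omega> + exp (- s * t))"
  proof (rule integral_mono_AE)
    show "AE \<omega> in M. exp (- s * D u \<omega>)
        \<le> indicator {\<omega> \<in> space M. D u \<omega> \<le> t} \<omega> + exp (- s * t)"
      using AE_D_nonneg[OF assms(1)] AE_space
    proof eventually_elim
      case (elim \<omega>)
      show ?case
      proof (cases "D u \<omega> \<le> t")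
        case True
        have "exp (- s * D u \<omega>) \<le> 1" using elim assms by simp
        then show ?thesis using True elim(2) by (simp add: add_increasing2)
      next
        case False
        then have "exp (- s * D u \<omega>) \<le> exp (- s * t)" using assms by (simp add: mult_left_mono)
        then show ?thesis by (simp add: add_increasing)
      qed
    qed
  qed (use integrable_exp_D[OF assms] int in auto)
  also have "\<dots> = prob {\<omega> \<in> space M. D u \<omega> \<le> t} + exp (- s * t)"
    using int assms(1) by (subst Bochner_Integration.integral_add) (auto simp: prob_space)
  finally show ?thesis by simp
qed

section \<open>Bounds on the exponential moment in terms of the distribution of
  \<open>D\<close>\<close>

text \<open>An infinite inverse keeps every \<open>D n\<close> at or below \<open>t\<close>. The
  Chernoff bound with s = 1 makes the probability of this smaller than terms that tend to 0.\<close>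

lemma AE_inverse_subordinator_finite:
  assumes "laplace_exponent \<nu> 1 > 0"
  shows "AE \<omega> in M. inverse_subordinator D t \<omega> < \<infinity>"
proof -
  define A where "A = (\<Inter>n. {\<omega> \<in> space M. D (real n) \<omega> \<le> t})"
  have A [measurable]: "A \<in> sets M" unfolding A_def by measurable
  have "prob A \<le> exp (1 * t - real n * laplace_exponent \<nu> 1)" for n
    by (rule order_trans[OF finite_measure_mono prob_D_le_upper]) (auto simp: A_def)
  moreover have "(\<lambda>n. exp (1 * t - real n * laplace_exponent \<nu> 1)) \<longlonglongrightarrow> 0"
    using assms by real_asymp
  ultimately have "prob A \<le> 0"
    by (intro LIMSEQ_le_const) auto
  then have "AE \<omega> in M. \<omega> \<notin> A"
    using A by (intro AE_not_in null_setsI) (auto simp: emeasure_eq_measure measure_le_0_iff)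
  then show ?thesis
    using AE_space AE_mono_on_D AE_D_0
  proof eventually_elim
    case (elim \<omega>)
    then obtain n where n: "D (real n) \<omega> > t" by (auto simp: A_def not_le)
    \<comment> \<open>Here \<open>n\<close> may be 0, but the infimum ranges over positive times;
      one further unit of time makes the index positive.\<close>
    have "D (real n) \<omega> \<le> D (real n + 1) \<omega>" using elim(3) by (rule mono_onD) auto
    then have "inverse_subordinator D t \<omega> \<le> ereal (real n + 1)"
      unfolding inverse_subordinator_def using n by (intro INF_lower) auto
    then show ?case by (rule le_less_trans) simp
  qed
qed

text \<open>
  No measurability of the inverse is needed: the nonnegative integral is monotone for arbitrary
  integrands, and only the dominating function is integrated.
\<close>
lemma exp_moment_inverse_finite:
  assumes "t \<ge> 0"
    and g: "\<And>n x. real n < x \<Longrightarrow> x \<le> real n + 1 \<Longrightarrow> f x \<le> g n"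
    and sum: "summable (\<lambda>n. exp (g n) * prob {\<omega> \<in> space M. D (real n) \<omega> \<le> t})"
  shows "exp_moment_inverse M D f t < \<infinity>"
proof -
  define B where "B = (\<lambda>n::nat. {\<omega> \<in> space M. D (real n) \<omega> \<le> t})"
  have B [measurable]: "B n \<in> sets M" for n unfolding B_def by measurable
  have "exp_moment_inverse M D f t
      \<le> (\<integral>\<^sup>+\<omega>. ennreal (exp (f 0)) + (\<Sum>n. ennreal (exp (g n)) * indicator (B n) \<omega>) \<partial>M)"
    unfolding exp_moment_inverse_def
  proof (rule nn_integral_mono_AE)
    show "AE \<omega> in M. ennreal (exp (f (real_of_ereal (inverse_subordinator D t \<omega>))))
        \<le> ennreal (exp (f 0)) + (\<Sum>n. ennreal (exp (g n)) * indicator (B n) \<omega>)"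
      using AE_space AE_D_0
    proof eventually_elim
      case (elim \<omega>)
      define x where "x = real_of_ereal (inverse_subordinator D t \<omega>)"
      have "x \<ge> 0"
        unfolding x_def by (intro real_of_ereal_pos inverse_subordinator_nonneg)
      show ?case
      proof (cases "x = 0")
        \<comment> \<open>\<open>real_of_ereal\<close> sends \<infinity> to 0, so this case covers
          an infinite inverse as well as a vanishing one; the summand \<open>exp (f 0)\<close> pays
          for both.\<close>
        case True
        then show ?thesis by (simp add: x_def)
      next
        case False
        then have E: "inverse_subordinator D t \<omega> = ereal x"
          unfolding x_def by (cases "inverse_subordinator D t \<omega>") auto
        \<comment> \<open>The ceiling puts \<open>x\<close> into the half-open interval (n, n + 1],
          with the strict lower inequality that \<open>le_of_less_inverse_subordinator\<close>
          requires.\<close>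
        define n where "n = nat (\<lceil>x\<rceil> - 1)"
        have n: "real n < x" "x \<le> real n + 1"
          unfolding n_def using False \<open>x \<ge> 0\<close> by linarith+
        \<comment> \<open>Time 0 lies outside the range of the infimum, so n = 0 is settled by
          \<open>D 0 \<omega> = 0\<close> and \<open>t \<ge> 0\<close>.\<close>
        have "D (real n) \<omega> \<le> t"
        proof (cases "n = 0")
          case True
          then show ?thesis using elim(2) \<open>t \<ge> 0\<close> by simp
        next
          case False
          then show ?thesis using n(1) E by (intro le_of_less_inverse_subordinator) auto
        qed
        then have "ennreal (exp (g n)) = ennreal (exp (g n)) * indicator (B n) \<omega>"
          using elim(1) by (simp add: B_def)
        also have "\<dots> \<le> (\<Sum>n. ennreal (exp (g n)) * indicator (B n) \<omega>)"
          using sum_le_suminf[OF summableI, of "{n}" "\<lambda>n. ennreal (exp (g n)) * indicator (B n) \<omega>"]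
          by (simp del: sum_mult_indicator)
        finally have "ennreal (exp (f x)) \<le> (\<Sum>n. ennreal (exp (g n)) * indicator (B n) \<omega>)"
          using g[OF n] by (meson dual_order.trans ennreal_leI exp_le_cancel_iff)
        then show ?thesis by (simp add: x_def add_increasing)
      qed
    qed
  qed
  also have "\<dots> = ennreal (exp (f 0)) + (\<Sum>n. ennreal (exp (g n)) * emeasure M (B n))"
    by (simp add: nn_integral_add nn_integral_suminf nn_integral_cmult emeasure_space_1)
  also have "\<dots> = ennreal (exp (f 0)) + (\<Sum>n. ennreal (exp (g n) * prob (B n)))"
    by (simp add: emeasure_eq_measure ennreal_mult')
  also have "\<dots> < \<infinity>"
  proof -
    have "(\<Sum>n. ennreal (exp (g n) * prob (B n))) \<noteq> top"
      using sum unfolding B_def by (rule ennreal_suminf_neq_top) simp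
    then show ?thesis by (simp add: top.not_eq_extremum)
  qed
  finally show ?thesis .
qed

text \<open>On the event \<open>D u \<omega> \<le> t\<close> the inverse is at least
  \<open>u\<close>, so the integrand is at least \<open>exp c\<close>. Almost sure finiteness, from
  \<open>fin\<close>, keeps \<open>real_of_ereal\<close> from collapsing the inverse to 0.\<close>

lemma exp_moment_inverse_lower:
  assumes fin: "laplace_exponent \<nu> 1 > 0" and "u \<ge> 0"
    and c: "\<And>x. x \<ge> u \<Longrightarrow> c \<le> f x"
  shows "ennreal (exp c * prob {\<omega> \<in> space M. D u \<omega> \<le> t}) \<le> exp_moment_inverse M D f t"
proof -
  define B where "B = {\<omega> \<in> space M. D u \<omega> \<le> t}"
  have B [measurable]: "B \<in> sets M" unfolding B_def using \<open>u \<ge> 0\<close> by measurable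
  have "ennreal (exp c * prob B) = (\<integral>\<^sup>+\<omega>. ennreal (exp c) * indicator B \<omega> \<partial>M)"
    by (simp add: nn_integral_cmult emeasure_eq_measure ennreal_mult')
  also have "\<dots> \<le> exp_moment_inverse M D f t"
    unfolding exp_moment_inverse_def
  proof (rule nn_integral_mono_AE)
    show "AE \<omega> in M. ennreal (exp c) * indicator B \<omega>
        \<le> ennreal (exp (f (real_of_ereal (inverse_subordinator D t \<omega>))))"
      using AE_mono_on_D AE_inverse_subordinator_finite[OF fin, of t]
    proof eventually_elim
      case (elim \<omega>)
      show ?case
      proof (cases "\<omega> \<in> B")
        case True
        then have "ereal u \<le> inverse_subordinator D t \<omega>"
          using elim(1) \<open>u \<ge> 0\<close> by (intro le_inverse_subordinator) (auto simp: B_def)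
        then have "u \<le> real_of_ereal (inverse_subordinator D t \<omega>)"
          using elim(2) by (cases "inverse_subordinator D t \<omega>") auto
        then show ?thesis using c True by (simp add: ennreal_leI)
      qed simp
    qed
  qed
  finally show ?thesis by (simp add: B_def)
qed

end

section \<open>Choice of exponents on either side of the critical value\<close>

theorem theorem2p1:
  fixes M :: "'a measure"
    and D :: "real \<Rightarrow> 'a \<Rightarrow> real"
    and \<nu> :: "real measure"
    and f :: "real \<Rightarrow> real"
    and \<beta> p t :: real
  assumes "prob_space M" and "complete_measure M"
    and "subordinator M D \<nu>"
    and "emeasure \<nu> {0<..} = \<infinity>"
    and "0 \<le> \<beta>" and "\<beta> < 1"
    and "regularly_varying (laplace_exponent \<nu>) \<beta>"
    and "\<beta> = 0 \<Longrightarrow> filterlim (laplace_exponent \<nu>) at_top at_top"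
    and "\<beta> = 0 \<Longrightarrow> regularly_varying (deriv (laplace_exponent \<nu>)) (- 1)"
    and "f \<in> borel_measurable (restrict_space borel {0<..})"
    and "p > 0"
    and "regularly_varying f p"
    and "\<And>s0. 0 < s0 \<Longrightarrow> bdd_above (f ` {0<..s0})"
    and "t > 0"
  shows "(p < 1 / (1 - \<beta>) \<longleftrightarrow> \<beta> > (p - 1) / p) \<and>
         (p > 1 / (1 - \<beta>) \<longleftrightarrow> \<beta> < (p - 1) / p) \<and>
         (p < 1 / (1 - \<beta>) \<longrightarrow> exp_moment_inverse M D f t < \<infinity>) \<and>
         (p > 1 / (1 - \<beta>) \<longrightarrow> exp_moment_inverse M D f t = \<infinity>)"
proof (intro conjI impI)
  show "p < 1 / (1 - \<beta>) \<longleftrightarrow> \<beta> > (p - 1) / p" "p > 1 / (1 - \<beta>) \<longleftrightarrow> \<beta> < (p - 1) / p"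
    using \<open>p > 0\<close> \<open>\<beta> < 1\<close> by (auto simp: field_simps)
next
  interpret prob_space M by fact
  interpret subordinator_space M D \<nu> by unfold_locales fact
  let ?\<psi> = "laplace_exponent \<nu>"
  note \<psi>_bounds = regularly_varying_powr_bounds[OF measurable_laplace_exponent assms(7)]
  note f_bounds = regularly_varying_powr_bounds[OF assms(10,12)]
  {
    assume "p < 1 / (1 - \<beta>)"
    then obtain a where a: "p < a" "a < 1 / (1 - \<beta>)" using dense by blast
    have "a > 0" using a(1) \<open>p > 0\<close> by simp
    \<comment> \<open>At s = n^a the Chernoff exponent contains n * s^(\<beta> - e) = n^q. For e = 0
      the surplus of q over a would be 1 + a \<beta> - a, positive as a < 1 / (1 - \<beta>). This
      \<open>e\<close> spends half of it.\<close>
    define e where "e = (1 + a * \<beta> - a) / (2 * a)"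
    define q where "q = 1 + a * (\<beta> - e)"
    have "1 + a * \<beta> - a > 0" using a(2) \<open>\<beta> < 1\<close> by (simp add: field_simps)
    then have "e > 0" unfolding e_def using \<open>a > 0\<close> by simp
    have "q = a + (1 + a * \<beta> - a) / 2"
      unfolding q_def e_def using \<open>a > 0\<close> by (simp add: field_simps)
    then have "q > a" using \<open>1 + a * \<beta> - a > 0\<close> by simp
    have "eventually (\<lambda>s. s powr (\<beta> - e) \<le> ?\<psi> s) at_top"
      using \<psi>_bounds[OF \<open>e > 0\<close>] by eventually_elim simp
    moreover have "filterlim (\<lambda>n. real n powr a) at_top sequentially"
      using \<open>a > 0\<close> by real_asymp
    ultimately have ev_\<psi>: "eventually (\<lambda>n. (real n powr a) powr (\<beta> - e) \<le> ?\<psi> (real n powr a)) sequentially"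
      by (rule eventually_compose_filterlim)
    have ev_prob: "eventually (\<lambda>n. prob {\<omega> \<in> space M. D (real n) \<omega> \<le> t}
        \<le> exp (t * real n powr a - real n powr q)) sequentially"
      using ev_\<psi> eventually_gt_at_top[of 0]
    proof eventually_elim
      case (elim n)
      have "real n powr q = real n * (real n powr a) powr (\<beta> - e)"
        using elim(2) by (simp add: q_def powr_powr powr_add)
      also have "\<dots> \<le> real n * ?\<psi> (real n powr a)"
        using elim(1) by (intro mult_left_mono) auto
      finally have "exp (real n powr a * t - real n * ?\<psi> (real n powr a))
          \<le> exp (t * real n powr a - real n powr q)" by (simp add: mult.commute)
      with prob_D_le_upper[of "real n" "real n powr a" t] show ?case
        by (meson order_trans of_nat_0_le_iff powr_ge_zero)
    qed
    have "eventually (\<lambda>x. f x \<le> x powr a) at_top"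
      using f_bounds[of "a - p"] a(1) by (auto elim: eventually_mono)
    then obtain X where X: "\<And>x. x \<ge> X \<Longrightarrow> f x \<le> x powr a"
      by (auto simp: eventually_at_top_linorder)
    have "\<exists>b. \<forall>x. 0 < x \<and> x \<le> real n + 1 \<longrightarrow> f x \<le> b" for n :: nat
      using assms(13)[of "real n + 1"] by (force simp: bdd_above_def)
    then obtain b :: "nat \<Rightarrow> real" where b: "\<And>n x. 0 < x \<Longrightarrow> x \<le> real n + 1 \<Longrightarrow> f x \<le> b n"
      by metis
    \<comment> \<open>Below \<open>X\<close> the power bound may fail, and local boundedness of
      \<open>f\<close> takes over. Only finitely many terms are affected, so summability is
      not.\<close>
    define g where "g = (\<lambda>n. if real n \<ge> X then (real n + 1) powr a else b n)"
    show "exp_moment_inverse M D f t < \<infinity>"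
    proof (rule exp_moment_inverse_finite)
      fix n x assume nx: "real n < x" "x \<le> real n + 1"
      show "f x \<le> g n"
      proof (cases "real n \<ge> X")
        case True
        then have "f x \<le> x powr a" using nx by (intro X) simp
        also have "\<dots> \<le> (real n + 1) powr a" using nx \<open>a > 0\<close> by (intro powr_mono2) auto
        finally show ?thesis using True by (simp add: g_def)
      qed (use b nx in \<open>simp add: g_def\<close>)
    next
      \<comment> \<open>As q > a, the power n^q outweighs both terms of order n^a. The margin 2 ln n
        allows comparison with 1 / n^2.\<close>
      have "eventually (\<lambda>n. (real n + 1) powr a + t * real n powr a - real n powr q
          \<le> - 2 * ln (real n)) sequentially"
        using \<open>a > 0\<close> \<open>q > a\<close> \<open>t > 0\<close> by real_asymp
      moreover have "eventually (\<lambda>n. real n \<ge> X) sequentially"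
        using filterlim_real_sequentially by (auto simp: filterlim_at_top)
      ultimately have "eventually (\<lambda>n. norm (exp (g n) * prob {\<omega> \<in> space M. D (real n) \<omega> \<le> t})
          \<le> 1 / real n ^ 2) sequentially"
        using ev_prob eventually_gt_at_top[of 0]
      proof eventually_elim
        case (elim n)
        have "exp (g n) * prob {\<omega> \<in> space M. D (real n) \<omega> \<le> t}
            \<le> exp (g n) * exp (t * real n powr a - real n powr q)"
          using elim(3) by (intro mult_left_mono) auto
        also have "\<dots> \<le> exp (- 2 * ln (real n))"
          using elim(1,2) by (simp add: g_def flip: exp_add)
        also have "\<dots> = real n powr - 2" using elim(4) by (simp add: powr_def)
        also have "\<dots> = 1 / real n ^ 2"
          using elim(4) by (simp add: powr_minus_divide)
        finally show ?case by simp
      qed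
      then show "summable (\<lambda>n. exp (g n) * prob {\<omega> \<in> space M. D (real n) \<omega> \<le> t})"
        by (rule summable_comparison_test_ev) (use inverse_power_summable[of 2] in \<open>simp add: field_simps\<close>)
    qed (use \<open>t > 0\<close> in simp)
  }
  {
    assume "p > 1 / (1 - \<beta>)"
    then obtain a where a: "1 / (1 - \<beta>) < a" "a < p" using dense by blast
    have "a > 0" using a(1) \<open>\<beta> < 1\<close> by (meson diff_gt_0_iff_gt less_trans zero_less_divide_1_iff)
    \<comment> \<open>Mirror image of the first case: u \<psi>(u^a) is at most u^r for large u. For
      e = 0, r would fall short of a by a - a \<beta> - 1 > 0, and this \<open>e\<close> gives away
      half of the gap.\<close>
    define e where "e = (a - a * \<beta> - 1) / (2 * a)"
    define r where "r = 1 + a * (\<beta> + e)"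
    have "a - a * \<beta> - 1 > 0" using a(1) \<open>\<beta> < 1\<close> by (simp add: field_simps)
    then have "e > 0" unfolding e_def using \<open>a > 0\<close> by simp
    have "r = a - (a - a * \<beta> - 1) / 2"
      unfolding r_def e_def using \<open>a > 0\<close> by (simp add: field_simps)
    then have "r < a" using \<open>a - a * \<beta> - 1 > 0\<close> by simp
    have "r > 0" unfolding r_def using \<open>a > 0\<close> \<open>0 \<le> \<beta>\<close> \<open>e > 0\<close> by (simp add: add_pos_nonneg)
    have \<psi>1: "?\<psi> 1 > 0" using assms(7) by (simp add: regularly_varying_def)
    have "eventually (\<lambda>s. ?\<psi> s \<le> s powr (\<beta> + e)) at_top"
      using \<psi>_bounds[OF \<open>e > 0\<close>] by eventually_elim simp
    moreover have "filterlim (\<lambda>u::real. u powr a) at_top at_top"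
      using \<open>a > 0\<close> by real_asymp
    ultimately have ev_\<psi>: "eventually (\<lambda>u. ?\<psi> (u powr a) \<le> (u powr a) powr (\<beta> + e)) at_top"
      by (rule eventually_compose_filterlim)
    have "eventually (\<lambda>x. x powr a \<le> f x) at_top"
      using f_bounds[of "p - a"] a(2) by (auto elim: eventually_mono)
    \<comment> \<open>\<open>exp_moment_inverse_lower\<close> needs a bound on the whole half-line
      from \<open>u\<close>, not only at \<open>u\<close>.\<close>
    then have ev_f: "eventually (\<lambda>u. \<forall>x\<ge>u. x powr a \<le> f x) at_top"
      by (rule eventually_all_ge_at_top)
    have lower: "eventually (\<lambda>u. ennreal (exp (u powr a) * (exp (- (u powr r)) - exp (- t * u powr a)))
        \<le> exp_moment_inverse M D f t) at_top"
      using ev_\<psi> ev_f eventually_gt_at_top[of 0]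
    proof eventually_elim
      case (elim u)
      have "u * ?\<psi> (u powr a) \<le> u * (u powr a) powr (\<beta> + e)"
        using elim(1,3) by (intro mult_left_mono) auto
      also have "\<dots> = u powr r"
        using elim(3) by (simp add: r_def powr_powr powr_add distrib_left)
      finally have "exp (- (u powr r)) - exp (- t * u powr a)
          \<le> exp (- u * ?\<psi> (u powr a)) - exp (- (u powr a) * t)" by (simp add: mult.commute)
      also have "\<dots> \<le> prob {\<omega> \<in> space M. D u \<omega> \<le> t}"
        using elim(3) by (intro prob_D_le_lower) auto
      finally have "ennreal (exp (u powr a) * (exp (- (u powr r)) - exp (- t * u powr a)))
          \<le> ennreal (exp (u powr a) * prob {\<omega> \<in> space M. D u \<omega> \<le> t})"
        by (intro ennreal_leI mult_left_mono) auto
      also have "\<dots> \<le> exp_moment_inverse M D f t"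
      proof (rule exp_moment_inverse_lower[OF \<psi>1])
        fix x assume "x \<ge> u"
        then have "u powr a \<le> x powr a" using elim(3) \<open>a > 0\<close> by (intro powr_mono2) auto
        also have "\<dots> \<le> f x" using elim(2) \<open>x \<ge> u\<close> by simp
        finally show "u powr a \<le> f x" .
      qed (use elim(3) in simp)
      finally show ?case .
    qed
    \<comment> \<open>The expression equals exp(u^a - u^r) * (1 - exp(u^r - t u^a)). As r < a, the
      first factor diverges and the second tends to 1, even for t < 1.\<close>
    have lim: "filterlim (\<lambda>u. exp (u powr a) * (exp (- (u powr r)) - exp (- t * u powr a)))
        at_top at_top"
      using \<open>r > 0\<close> \<open>r < a\<close> \<open>t > 0\<close> by real_asymp
    have le: "ennreal c \<le> exp_moment_inverse M D f t" for c
    proof -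
      have "eventually (\<lambda>u. c \<le> exp (u powr a) * (exp (- (u powr r)) - exp (- t * u powr a))) at_top"
        using lim by (simp add: filterlim_at_top)
      \<comment> \<open>The moment does not depend on \<open>u\<close>, so letting \<open>u\<close>
        grow places it above every real \<open>c\<close>.\<close>
      with lower have "eventually (\<lambda>u::real. ennreal c \<le> exp_moment_inverse M D f t) at_top"
        by eventually_elim (meson ennreal_leI order_trans)
      then show ?thesis by simp
    qed
    show "exp_moment_inverse M D f t = \<infinity>"
    proof (cases "exp_moment_inverse M D f t")
      case (real r)
      then show ?thesis using le[of "r + 1"] by simp
    qed simp
  }
qed

end
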